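(* Given $\varepsilon>0$ and assuming that $n>d^2$, the total computational cost $\mathcal{C}(m)$ of PCG with a fixed SRHT of sketch size $m$ to reach an $(\varepsilon,\mathcal{O}(1/d))$-accurate solution satisfies the following. (i) Suppose that $\sqrt{\log(1/\varepsilon)}<\log(n/d^2)$. Then, for $m^*\asymp e^{\sqrt{\log(1/\varepsilon)}}\,d\log d$, we have the optimized complexity $$\mathcal{C}(m^* )=\mathcal{O}\Big(nd\,\big(\log d+\sqrt{\log(1/\varepsilon)}\big)\Big).$$ (ii) Suppose that $\sqrt{\log(1/\varepsilon)}\ge\log(n/d^2)$. Then, for $m^*\asymp\frac nd\cdot\max\big\{\log d,\ \frac{\log(1/\varepsilon)}{\log(n/d^2)}\big\}$, we have the optimized complexity $$\mathcal{C}(m^* )=\mathcal{O}\Big(nd\,\Big(\log d+\frac{\log(1/\varepsilon)}{\log(n/d^2)}\Big)\Big).$$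
   Context: Problem: minimize $f(x)=\frac12\|Ax\|_2^2-\langle b,x\rangle$ over $x\in\mathbb{R}^d$, with $A\in\mathbb{R}^{n\times d}$ of full column rank, $b\in\mathbb{R}^d$ and minimizer $x^*$, using the preconditioned conjugate gradient method (PCG) started at $x_0$ with the fixed preconditioner $A^\top S^\top SA$. Here $S\in\mathbb{R}^{m\times n}$ is a subsampled randomized Hadamard transform (SRHT), i.e. the product of a uniform (without replacement) row-subsampling matrix, the $n\times n$ Hadamard matrix and a diagonal matrix of random signs. An approximate solution $x_t$ is $(\varepsilon,\delta)$-accurate if its relative error $\|A(x_t-x^* )\|_2^2/\|A(x_0-x^* )\|_2^2$ is at most $\varepsilon$ with probability $1-\delta$. Cost model (flop count in an idealized RAM model, numerical constants discarded): for failure probability $\delta=\mathcal{O}(1/d)$, the critical sketch size of the SRHT is $m_\delta\asymp d\log d$; forming $SA$ costs $nd\log m$; the matrix factorization for the preconditioner costs $md^2$; each PCG iteration costs $nd$, and about $\log(1/\varepsilon)/\log(m/(d\log d))$ iterations are needed. The cost function, considered over $m>m_\delta$, is $$\mathcal{C}(m)=nd\log m+md^2+nd\,\frac{\log(1/\varepsilon)}{\log\!\big(m/(d\log d)\big)} .$$ The symbol $\asymp$ denotes equality up to numerical constants. *)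

theory Defs
  imports Complex_Main "HOL-Library.Landau_Symbols"
begin

text \<open>
  Cost model for the preconditioned conjugate gradient method (PCG) with preconditioner
  \<open>A\<^sup>T S\<^sup>T S A\<close>, where \<open>A\<close> is a real \<open>n \<times> d\<close> matrix of full column rank and \<open>S\<close> is an SRHT
  with \<open>m\<close> rows, run until the relative error is at most \<open>eps\<close> with failure probability
  \<open>O(1/d)\<close>. Costs are flop counts with numerical constants discarded; the model itself is
  the definition of the cost, so \<open>A\<close>, \<open>S\<close> and the failure probability enter only through
  \<open>n\<close>, \<open>d\<close>, \<open>m\<close> and \<open>eps\<close>. All logarithms are natural.
\<close>

definition sketch_cost :: "nat \<Rightarrow> nat \<Rightarrow> nat \<Rightarrow> real" where
  "sketch_cost n d m = real n * real d * ln (real m)"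

definition factorization_cost :: "nat \<Rightarrow> nat \<Rightarrow> real" where
  "factorization_cost d m = real m * (real d)\<^sup>2"

definition iteration_cost :: "nat \<Rightarrow> nat \<Rightarrow> real" where
  "iteration_cost n d = real n * real d"

text \<open>
  The idealized iteration count is not rounded. It is meaningful only above the critical
  sketch size: at or below \<open>d log d\<close> its denominator is not positive.
\<close>

definition iterations :: "nat \<Rightarrow> real \<Rightarrow> nat \<Rightarrow> real" where
  "iterations d eps m = ln (1 / eps) / ln (real m / (real d * ln (real d)))"

definition pcg_cost :: "nat \<Rightarrow> nat \<Rightarrow> real \<Rightarrow> nat \<Rightarrow> real" where
  "pcg_cost n d eps m =
     sketch_cost n d m + factorization_cost d m + iteration_cost n d * iterations d eps m"

text \<open>
  The critical sketch size is of order \<open>d log d\<close>; \<open>kappa\<close> is its numerical constant.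
  It is meant to satisfy \<open>kappa > 1\<close>, so that above the critical size the denominator in
  \<open>iterations\<close> is bounded away from 0.
\<close>

definition critical_size :: "real \<Rightarrow> nat \<Rightarrow> real" where
  "critical_size kappa d = kappa * (real d * ln (real d))"

text \<open>
  Parameter triples \<open>(n, d, eps)\<close>. For \<open>d = 1\<close> the quantity \<open>d log d\<close> vanishes and the iteration
  count is undefined; for \<open>eps > 1\<close> the square root of \<open>log (1 / eps)\<close> is undefined.
\<close>

definition params :: "(nat \<times> nat \<times> real) set" where
  "params = {(n, d, eps). d \<ge> 2 \<and> n > d\<^sup>2 \<and> 0 < eps \<and> eps \<le> 1}"

definition regime1 :: "(nat \<times> nat \<times> real) set" where
  "regime1 = {(n, d, eps) \<in> params. sqrt (ln (1 / eps)) < ln (real n / (real d)\<^sup>2)}"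

definition regime2 :: "(nat \<times> nat \<times> real) set" where
  "regime2 = {(n, d, eps) \<in> params. sqrt (ln (1 / eps)) \<ge> ln (real n / (real d)\<^sup>2)}"

text \<open>
  A choice \<open>ms\<close> of the sketch size as a function of the parameters that is admissible (above
  the critical size) and equal to \<open>X\<close> up to numerical constants. Landau symbols with respect
  to \<open>principal D\<close> are estimates whose constants are uniform over all of \<open>D\<close>, not only
  asymptotic ones.
\<close>

definition sketch_choice ::
  "real \<Rightarrow> (nat \<times> nat \<times> real) set \<Rightarrow> (nat \<times> nat \<times> real \<Rightarrow> real) \<Rightarrow> (nat \<times> nat \<times> real \<Rightarrow> nat) \<Rightarrow> bool"
  where
  "sketch_choice kappa D X ms \<longleftrightarrow>
     (\<forall>(n, d, eps) \<in> D. real (ms (n, d, eps)) > critical_size kappa d) \<and>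
     (\<lambda>p. real (ms p)) \<in> \<Theta>[principal D](X)"

end

theory Submission
  imports Defs
begin

text \<open>
  Both regimes are instances of one estimate. Put \<open>L = log (1 / eps)\<close> and let \<open>0 \<le> t \<le> T\<close> satisfy
  \<open>T t = L\<close> and \<open>exp t \<le> n / d\<^sup>2\<close>. If the sketch size \<open>m\<close> lies, up to constants, between
  \<open>exp t d log d\<close> and \<open>exp t d (log d + T)\<close>, then \<open>log m = O(log d + T)\<close> and
  \<open>m d\<^sup>2 = O(n d (log d + T))\<close>, and since \<open>log (m / (d log d))\<close> dominates \<open>t\<close> up to a constant,
  the number of iterations is \<open>O(L / t) = O(T)\<close>. The first regime is \<open>t = T = sqrt L\<close>;
  the second is \<open>t = log (n / d\<^sup>2)\<close>, \<open>T = L / t\<close>.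
\<close>

lemma ln_2_ge_half: "ln (2::real) \<ge> 1/2"
  using ln_le_minus_one[of "1/2::real"] by (simp add: ln_div)

text \<open>This makes every size above the critical one exceed 1, and later lets a rounding error
  of 1 be absorbed into a multiple of the target size.\<close>

lemma d_ln_d_ge_one:
  assumes "d \<ge> (2::nat)"
  shows "real d * ln (real d) \<ge> 1"
proof -
  have "ln 2 \<le> ln (real d)" using assms by simp
  then have "ln (real d) \<ge> 1/2" using ln_2_ge_half by linarith
  then have "2 * (1/2) \<le> real d * ln (real d)" using assms by (intro mult_mono) auto
  then show ?thesis by simp
qed

text \<open>
  For small \<open>t\<close> the bound \<open>c exp t\<close> may drop below 1, and only \<open>k > 1\<close> keeps \<open>ln q\<close> away from 0.
\<close>

lemma exponent_le_const_ln:
  fixes k c :: real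
  assumes "k > 1" "c > 0"
  obtains b where "b > 0" "\<And>q t. q > k \<Longrightarrow> c * exp t \<le> q \<Longrightarrow> t \<le> b * ln q"
proof
  \<comment> \<open>From \<open>c * exp t \<le> q\<close> one gets
    \<open>t \<le> ln q + \<bar>ln c\<bar>\<close>; as \<open>ln q \<ge> ln k > 0\<close>, the
    constant \<open>\<bar>ln c\<bar>\<close> is at most \<open>\<bar>ln c\<bar> / ln k\<close> times
    \<open>ln q\<close>.\<close>
  let ?b = "1 + \<bar>ln c\<bar> / ln k"
  have k: "ln k > 0" using assms by simp
  then show "?b > 0" by (simp add: add_pos_nonneg)
  fix q t :: real
  assume q: "q > k" "c * exp t \<le> q"
  have "ln k \<le> ln q" using q assms by simp
  then have "\<bar>ln c\<bar> / ln k * ln k \<le> \<bar>ln c\<bar> / ln k * ln q"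
    using k by (intro mult_left_mono) auto
  moreover have "ln c + t \<le> ln q"
  proof -
    have "ln (c * exp t) \<le> ln q" using q assms by (intro ln_mono) auto
    then show ?thesis using assms by (simp add: ln_mult)
  qed
  ultimately show "t \<le> ?b * ln q" using k by (simp add: algebra_simps)
qed

text \<open>\<open>C\<close> is obtained before the parameters and the sketch size are quantified,
  so it depends only on \<open>kappa\<close>, \<open>c1\<close>, \<open>c2\<close>. This is the
  uniformity demanded by estimates over \<open>principal D\<close>.\<close>

lemma pcg_cost_bound:
  fixes kappa c1 c2 :: real
  assumes "kappa > 1" "c1 > 0" "c2 > 0"
  obtains C where
    "\<And>n d eps m t T. d \<ge> 2 \<Longrightarrow> 0 \<le> t \<Longrightarrow> t \<le> T \<Longrightarrow> ln (1 / eps) = T * t \<Longrightarrow>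
       exp t \<le> real n / (real d)\<^sup>2 \<Longrightarrow> real m > critical_size kappa d \<Longrightarrow>
       c1 * (exp t * (real d * ln (real d))) \<le> real m \<Longrightarrow>
       real m \<le> c2 * (exp t * (real d * (ln (real d) + T))) \<Longrightarrow>
       \<bar>pcg_cost n d eps m\<bar> \<le> C * (real n * real d * (ln (real d) + T))"
proof -
  obtain b where b: "b > 0"
    "\<And>q t. q > kappa \<Longrightarrow> c1 * exp t \<le> q \<Longrightarrow> t \<le> b * ln q"
    using exponent_le_const_ln[OF assms(1,2)] by blast
  \<comment> \<open>The summands come from sketching, factorization and iterations, in this
    order.\<close>
  let ?C = "(2 * c2 + 2) + c2 + b"
  show ?thesis
  proof (rule that[of ?C])
    fix n d m :: nat and eps t T :: real
    assume d: "d \<ge> 2" and t: "0 \<le> t" "t \<le> T" and L: "ln (1 / eps) = T * t"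
      and r: "exp t \<le> real n / (real d)\<^sup>2" and crit: "real m > critical_size kappa d"
      and lo: "c1 * (exp t * (real d * ln (real d))) \<le> real m"
      and hi: "real m \<le> c2 * (exp t * (real d * (ln (real d) + T)))"
    define D where "D = real d * ln (real d)"
    define B where "B = ln (real d) + T"
    define nd where "nd = real n * real d"
    have D: "D \<ge> 1" using d_ln_d_ge_one[OF d] by (simp add: D_def)
    have "ln 2 \<le> ln (real d)" using d by simp
    then have B: "B \<ge> 1/2" "T \<le> B" "ln (real d) \<le> B" "t + ln (real d) \<le> B"
      using ln_2_ge_half t by (auto simp: B_def)
    have nd: "nd \<ge> 0" by (simp add: nd_def)
    have mD: "real m > kappa * D" using crit by (simp add: critical_size_def D_def)
    \<comment> \<open>With \<open>m > 1\<close> the sketching term is nonnegative, which helps to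
      remove the absolute value of the cost at the end.\<close>
    have "kappa * D > 1 * 1" using assms D by (intro mult_less_le_imp_less) auto
    then have m: "real m > 1" using mD by simp

    have ln_m: "ln (real m) \<le> (2 * c2 + 2) * B"
    proof -
      have "ln (real m) \<le> ln (c2 * (exp t * (real d * B)))"
        using m hi by (intro ln_mono) (auto simp: B_def)
      also have "\<dots> = ln c2 + (t + (ln (real d) + ln B))"
        using assms d B by (simp add: ln_mult)
      \<comment> \<open>One \<open>B\<close> bounds \<open>t + ln (real d)\<close>, because
        \<open>t \<le> T\<close>; the other bounds \<open>ln B\<close>. The remaining
        \<open>c2\<close> is then absorbed using \<open>B \<ge> 1/2\<close>.\<close>
      also have "\<dots> \<le> c2 + 2 * B"
        using ln_bound[of c2] ln_bound[of B] assms B by linarith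
      also have "\<dots> \<le> (2 * c2 + 2) * B"
        using mult_left_mono[OF B(1), of "2 * c2"] assms by (simp add: algebra_simps)
      finally show ?thesis .
    qed

    have fact: "real m * (real d)\<^sup>2 \<le> c2 * (nd * B)"
    proof -
      have "real m * (real d)\<^sup>2 \<le> c2 * (exp t * (real d * B)) * (real d)\<^sup>2"
        using hi by (intro mult_right_mono) (auto simp: B_def)
      \<comment> \<open>Regrouped to isolate \<open>exp t * d^2\<close>, which is at most
        \<open>n\<close>.\<close>
      also have "\<dots> = (exp t * (real d)\<^sup>2) * (c2 * (real d * B))" by simp
      also have "\<dots> \<le> real n * (c2 * (real d * B))"
      proof (intro mult_right_mono)
        show "exp t * (real d)\<^sup>2 \<le> real n" using r d by (simp add: field_simps)
      qed (use assms B in auto)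
      finally show ?thesis by (simp add: nd_def mult_ac)
    qed

    let ?q = "real m / D"
    have q: "?q > kappa" using mD D by (simp add: field_simps)
    have lnq: "ln ?q > 0" using q assms by simp
    have "c1 * exp t \<le> ?q" using lo D by (simp add: field_simps D_def[symmetric])
    \<comment> \<open>Multiplying by \<open>T\<close> instead of dividing by \<open>t\<close> also
      covers \<open>t = 0\<close>, which occurs in the first regime when
      \<open>eps = 1\<close>.\<close>
    then have "T * t \<le> T * (b * ln ?q)" using b(2)[OF q] t by (intro mult_left_mono) auto
    then have "T * t / ln ?q \<le> b * T" using lnq by (simp add: field_simps)
    also have "\<dots> \<le> b * B" using b B by simp
    finally have iter: "iterations d eps m \<le> b * B" by (simp add: iterations_def L D_def)
    have iter0: "iterations d eps m \<ge> 0"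
      using lnq t by (simp add: iterations_def L D_def)

    have cost: "pcg_cost n d eps m = nd * ln (real m) + real m * (real d)\<^sup>2 + nd * iterations d eps m"
      by (simp add: pcg_cost_def sketch_cost_def factorization_cost_def iteration_cost_def nd_def)
    have "pcg_cost n d eps m \<ge> 0" unfolding cost using nd m iter0 by simp
    moreover have "pcg_cost n d eps m \<le> nd * ((2 * c2 + 2) * B) + c2 * (nd * B) + nd * (b * B)"
      unfolding cost using ln_m fact iter nd by (intro add_mono mult_left_mono) auto
    ultimately show "\<bar>pcg_cost n d eps m\<bar>
        \<le> ?C * (real n * real d * (ln (real d) + T))"
      unfolding nd_def[symmetric] B_def[symmetric] by (simp add: algebra_simps)
  qed
qed

text \<open>Rounding \<open>kappa * X\<close> up to an integer works: \<open>X \<ge> d log d\<close>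
  puts it above the critical size, and \<open>X \<ge> 1\<close> keeps it within
  \<open>(kappa + 1) * X\<close>.\<close>

lemma sketch_choice_exists:
  assumes kappa: "kappa > 1"
    and X: "\<And>n d eps. (n, d, eps) \<in> D \<Longrightarrow> d \<ge> 2 \<and> real d * ln (real d) \<le> X (n, d, eps)"
  shows "\<exists>ms. sketch_choice kappa D X ms"
proof -
  define ms where "ms p = nat \<lfloor>kappa * X p\<rfloor> + 1" for p
  have X1: "X p \<ge> 1" if "p \<in> D" for p
    using X d_ln_d_ge_one that by (cases p) force
  have ms: "kappa * X p < real (ms p)" "real (ms p) \<le> (kappa + 1) * X p" if "p \<in> D" for p
  proof -
    have "real (ms p) = of_int \<lfloor>kappa * X p\<rfloor> + 1"
      using X1[OF that] kappa by (simp add: ms_def)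
    moreover have "of_int \<lfloor>kappa * X p\<rfloor> \<le> kappa * X p" "kappa * X p < of_int \<lfloor>kappa * X p\<rfloor> + 1"
      by linarith+
    ultimately show "kappa * X p < real (ms p)" "real (ms p) \<le> (kappa + 1) * X p"
      using X1[OF that] unfolding distrib_right by linarith+
  qed
  have "critical_size kappa d < real (ms (n, d, eps))" if "(n, d, eps) \<in> D" for n d eps
  proof -
    have "critical_size kappa d \<le> kappa * X (n, d, eps)"
      using X[OF that] kappa by (simp add: critical_size_def)
    then show ?thesis using ms(1)[OF that] by simp
  qed
  moreover have "(\<lambda>p. real (ms p)) \<in> O[principal D](X)"
    using ms(2) X1 by (intro landau_o.bigI[of "kappa + 1"])
      (use kappa in \<open>fastforce simp: eventually_principal\<close>)+
  moreover have "(\<lambda>p. real (ms p)) \<in> \<Omega>[principal D](X)"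
    using ms(1) X1 by (intro landau_omega.bigI[of kappa])
      (use kappa in \<open>fastforce simp: eventually_principal\<close>)+
  ultimately have "sketch_choice kappa D X ms"
    by (auto simp: sketch_choice_def bigtheta_def)
  then show ?thesis by blast
qed

text \<open>A size of order \<open>X\<close> inherits the two-sided bounds on \<open>X\<close> up to
  constants, as the cost estimate requires. The existence claim ensures that the bound for all
  choices is not vacuous.\<close>

lemma optimized_complexity:
  fixes t T :: "nat \<times> nat \<times> real \<Rightarrow> real"
  assumes kappa: "kappa > 1"
    and D: "\<And>n d eps. (n, d, eps) \<in> D \<Longrightarrow> d \<ge> 2 \<and>
       0 \<le> t (n, d, eps) \<and> t (n, d, eps) \<le> T (n, d, eps) \<and>
       ln (1 / eps) = T (n, d, eps) * t (n, d, eps) \<and>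
       exp (t (n, d, eps)) \<le> real n / (real d)\<^sup>2 \<and>
       exp (t (n, d, eps)) * (real d * ln (real d)) \<le> X (n, d, eps) \<and>
       X (n, d, eps) \<le> exp (t (n, d, eps)) * (real d * (ln (real d) + T (n, d, eps)))"
  shows "(\<exists>ms. sketch_choice kappa D X ms) \<and>
    (\<forall>ms. sketch_choice kappa D X ms \<longrightarrow>
      (\<lambda>(n, d, eps). pcg_cost n d eps (ms (n, d, eps)))
        \<in> O[principal D](\<lambda>(n, d, eps). real n * real d * (ln (real d) + T (n, d, eps))))"
proof (intro conjI allI impI)
  have X: "real d * ln (real d) \<le> X (n, d, eps)" if "(n, d, eps) \<in> D" for n d eps
  proof -
    have "1 * (real d * ln (real d)) \<le> exp (t (n, d, eps)) * (real d * ln (real d))"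
      using D[OF that] by (intro mult_right_mono) auto
    then show ?thesis using D[OF that] by linarith
  qed
  then show "\<exists>ms. sketch_choice kappa D X ms"
    using D by (intro sketch_choice_exists[OF kappa]) blast
  fix ms
  assume "sketch_choice kappa D X ms"
  then have crit: "\<And>n d eps. (n, d, eps) \<in> D \<Longrightarrow> real (ms (n, d, eps)) > critical_size kappa d"
    and O: "(\<lambda>p. real (ms p)) \<in> O[principal D](X)"
    and Om: "(\<lambda>p. real (ms p)) \<in> \<Omega>[principal D](X)"
    by (auto simp: sketch_choice_def bigtheta_def)
  \<comment> \<open>For a principal filter, "eventually" means at every point of \<open>D\<close>,
    so the Landau constants hold pointwise.\<close>
  from O obtain c2 where c2: "c2 > 0" "\<And>p. p \<in> D \<Longrightarrow> real (ms p) \<le> c2 * \<bar>X p\<bar>"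
    by (elim landau_o.bigE) (auto simp: eventually_principal)
  from Om obtain c1 where c1: "c1 > 0" "\<And>p. p \<in> D \<Longrightarrow> real (ms p) \<ge> c1 * \<bar>X p\<bar>"
    by (elim landau_omega.bigE) (auto simp: eventually_principal)
  obtain C where C:
    "\<And>n d eps m t T. d \<ge> 2 \<Longrightarrow> 0 \<le> t \<Longrightarrow> t \<le> T \<Longrightarrow> ln (1 / eps) = T * t \<Longrightarrow>
       exp t \<le> real n / (real d)\<^sup>2 \<Longrightarrow> real m > critical_size kappa d \<Longrightarrow>
       c1 * (exp t * (real d * ln (real d))) \<le> real m \<Longrightarrow>
       real m \<le> c2 * (exp t * (real d * (ln (real d) + T))) \<Longrightarrow>
       \<bar>pcg_cost n d eps m\<bar> \<le> C * (real n * real d * (ln (real d) + T))"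
    using pcg_cost_bound[OF kappa c1(1) c2(1)] by blast
  have "\<bar>pcg_cost n d eps (ms (n, d, eps))\<bar>
      \<le> C * \<bar>real n * real d * (ln (real d) + T (n, d, eps))\<bar>" if p: "(n, d, eps) \<in> D" for n d eps
  proof -
    note Dp = D[OF p]
    have X0: "X (n, d, eps) \<ge> 0" using X[OF p] d_ln_d_ge_one[of d] Dp by linarith
    have "\<bar>pcg_cost n d eps (ms (n, d, eps))\<bar>
        \<le> C * (real n * real d * (ln (real d) + T (n, d, eps)))"
    proof (rule C)
      show "c1 * (exp (t (n, d, eps)) * (real d * ln (real d))) \<le> real (ms (n, d, eps))"
        using c1(2)[OF p] X0 Dp c1(1) mult_left_mono[of _ "X (n, d, eps)" c1]
        by (smt (verit))
      show "real (ms (n, d, eps))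
          \<le> c2 * (exp (t (n, d, eps)) * (real d * (ln (real d) + T (n, d, eps))))"
        using c2(2)[OF p] X0 Dp c2(1) mult_left_mono[of "X (n, d, eps)" _ c2]
        by (smt (verit))
    qed (use Dp crit[OF p] in auto)
    moreover have "real n * real d * (ln (real d) + T (n, d, eps)) \<ge> 0" using Dp by auto
    ultimately show ?thesis by simp
  qed
  then show "(\<lambda>(n, d, eps). pcg_cost n d eps (ms (n, d, eps)))
      \<in> O[principal D](\<lambda>(n, d, eps). real n * real d * (ln (real d) + T (n, d, eps)))"
    by (intro bigoI[where c = C]) (auto simp: eventually_principal)
qed

theorem theorem6p1:
  fixes kappa :: real
    and X1 X2 :: "nat \<times> nat \<times> real \<Rightarrow> real"
  assumes kappa: "kappa > 1"
  defines "X1 \<equiv> (\<lambda>(n, d, eps). exp (sqrt (ln (1 / eps))) * (real d * ln (real d)))"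
    and "X2 \<equiv> (\<lambda>(n, d, eps).
           real n / real d * max (ln (real d)) (ln (1 / eps) / ln (real n / (real d)\<^sup>2)))"
  shows
    "((\<exists>ms. sketch_choice kappa regime1 X1 ms) \<and>
      (\<forall>ms. sketch_choice kappa regime1 X1 ms \<longrightarrow>
        (\<lambda>(n, d, eps). pcg_cost n d eps (ms (n, d, eps)))
          \<in> O[principal regime1](\<lambda>(n, d, eps).
              real n * real d * (ln (real d) + sqrt (ln (1 / eps))))))
     \<and>
     ((\<exists>ms. sketch_choice kappa regime2 X2 ms) \<and>
      (\<forall>ms. sketch_choice kappa regime2 X2 ms \<longrightarrow>
        (\<lambda>(n, d, eps). pcg_cost n d eps (ms (n, d, eps)))
          \<in> O[principal regime2](\<lambda>(n, d, eps).
              real n * real d * (ln (real d) + ln (1 / eps) / ln (real n / (real d)\<^sup>2)))))"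
proof
  have ratio: "real n / (real d)\<^sup>2 > 1" "ln (1 / eps) \<ge> 0" "d \<ge> 2"
    if "(n, d, eps) \<in> params" for n d eps
  proof -
    have "real (d\<^sup>2) < real n" using that by (simp add: params_def del: of_nat_power)
    then show "real n / (real d)\<^sup>2 > 1" "ln (1 / eps) \<ge> 0" "d \<ge> 2"
      using that by (auto simp: params_def)
  qed
  let ?s = "\<lambda>(n::nat, d::nat, eps). sqrt (ln (1 / eps))"
  let ?r = "\<lambda>(n, d, eps::real). ln (real n / (real d)\<^sup>2)"
  let ?T = "\<lambda>(n, d, eps). ln (1 / eps) / ln (real n / (real d)\<^sup>2)"

  \<comment> \<open>Exponentiating the regime condition gives \<open>exp t \<le> n / d^2\<close>.
    \<open>X1\<close> is exactly the lower end of the allowed range.\<close>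
  have 1: "d \<ge> 2 \<and> 0 \<le> ?s (n, d, eps) \<and> ?s (n, d, eps) \<le> ?s (n, d, eps) \<and>
      ln (1 / eps) = ?s (n, d, eps) * ?s (n, d, eps) \<and>
      exp (?s (n, d, eps)) \<le> real n / (real d)\<^sup>2 \<and>
      exp (?s (n, d, eps)) * (real d * ln (real d)) \<le> X1 (n, d, eps) \<and>
      X1 (n, d, eps) \<le> exp (?s (n, d, eps)) * (real d * (ln (real d) + ?s (n, d, eps)))"
    if "(n, d, eps) \<in> regime1" for n d eps
  proof -
    have p: "(n, d, eps) \<in> params" and s: "sqrt (ln (1 / eps)) < ln (real n / (real d)\<^sup>2)"
      using that by (auto simp: regime1_def)
    have pos: "real n / (real d)\<^sup>2 > 0" using ratio(1)[OF p] by linarith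
    have "exp (sqrt (ln (1 / eps))) \<le> exp (ln (real n / (real d)\<^sup>2))"
      using s by (simp only: exp_le_cancel_iff)
    then have "exp (sqrt (ln (1 / eps))) \<le> real n / (real d)\<^sup>2"
      using pos by (simp only: exp_ln)
    then show ?thesis
      using ratio(2,3)[OF p] by (simp add: X1_def mult_left_mono)
  qed
  from optimized_complexity[where t = ?s and T = ?s and X = X1 and D = regime1, OF kappa 1]
  show "(\<exists>ms. sketch_choice kappa regime1 X1 ms) \<and>
      (\<forall>ms. sketch_choice kappa regime1 X1 ms \<longrightarrow>
        (\<lambda>(n, d, eps). pcg_cost n d eps (ms (n, d, eps)))
          \<in> O[principal regime1](\<lambda>(n, d, eps).
              real n * real d * (ln (real d) + sqrt (ln (1 / eps)))))"
    by simp

  \<comment> \<open>Now \<open>exp t = n / d^2\<close>, so \<open>n / d = exp t * d\<close>.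
    \<open>X2\<close> lies in the range because the maximum of \<open>log d\<close> and
    \<open>T\<close> is between \<open>log d\<close> and \<open>log d + T\<close>.\<close>
  have 2: "d \<ge> 2 \<and> 0 \<le> ?r (n, d, eps) \<and> ?r (n, d, eps) \<le> ?T (n, d, eps) \<and>
      ln (1 / eps) = ?T (n, d, eps) * ?r (n, d, eps) \<and>
      exp (?r (n, d, eps)) \<le> real n / (real d)\<^sup>2 \<and>
      exp (?r (n, d, eps)) * (real d * ln (real d)) \<le> X2 (n, d, eps) \<and>
      X2 (n, d, eps) \<le> exp (?r (n, d, eps)) * (real d * (ln (real d) + ?T (n, d, eps)))"
    if "(n, d, eps) \<in> regime2" for n d eps
  proof -
    have p: "(n, d, eps) \<in> params" and s: "sqrt (ln (1 / eps)) \<ge> ln (real n / (real d)\<^sup>2)"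
      using that by (auto simp: regime2_def)
    define L where "L = ln (1 / eps)"
    define r where "r = real n / (real d)\<^sup>2"
    define T where "T = L / ln r"
    have r: "r > 1" and L: "L \<ge> 0" and d: "d \<ge> 2"
      using ratio[OF p] by (simp_all add: r_def L_def)
    have lnr: "ln r > 0" using r by simp
    \<comment> \<open>Squaring the regime condition and dividing by \<open>ln r > 0\<close> yields
      \<open>t \<le> T\<close>.\<close>
    have "ln r * ln r \<le> sqrt L * sqrt L"
      using s lnr L by (intro mult_mono) (simp_all add: L_def r_def)
    then have rT: "ln r \<le> T" using L lnr by (simp add: T_def field_simps)
    then have T0: "T \<ge> 0" using lnr by linarith
    have nd: "real n / real d = r * real d"
      using d by (simp add: r_def power2_eq_square)
    have "r * (real d * ln (real d)) \<le> r * (real d * max (ln (real d)) T)"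
      and "r * (real d * max (ln (real d)) T) \<le> r * (real d * (ln (real d) + T))"
      using r d T0 by (auto intro!: mult_left_mono)
    moreover have "L = T * ln r" using lnr by (simp add: T_def)
    ultimately show ?thesis
      unfolding X2_def prod.case L_def[symmetric] r_def[symmetric] T_def[symmetric] nd
      using r lnr d rT T0 by (simp add: mult.assoc)
  qed
  from optimized_complexity[where t = ?r and T = ?T and X = X2 and D = regime2, OF kappa 2]
  show "(\<exists>ms. sketch_choice kappa regime2 X2 ms) \<and>
      (\<forall>ms. sketch_choice kappa regime2 X2 ms \<longrightarrow>
        (\<lambda>(n, d, eps). pcg_cost n d eps (ms (n, d, eps)))
          \<in> O[principal regime2](\<lambda>(n, d, eps).
              real n * real d * (ln (real d) + ln (1 / eps) / ln (real n / (real d)\<^sup>2))))"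
    by simp
qed

end
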